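(* If there exists an optimal policy $\pi_*$, that is, a policy whose value function $v_*=v_{\pi_*}$ satisfies $v\le v_*$ pointwise on $\mathcal X$ for every $v\in\mathcal V_{\mathsf a}$, then $v_*$ satisfies the Hamilton–Jacobi–Bellman equation $$\alpha\,v_*(x)=\max_{u\in\mathcal U}h(x,u,\nabla v_*(x))\qquad\forall x\in\mathcal X,$$ and $\pi_*$ satisfies $$\pi_*(x)\in\arg\max_{u\in\mathcal U}h(x,u,\nabla v_*(x))\qquad\forall x\in\mathcal X.$$
   Context: State space $\mathcal X=\mathbb R^l$, $\mathcal X^{\mathsf T}=\mathbb R^{1\times l}$, time space $\mathbb T=[0,\infty)$. The action space $\mathcal U\subseteq\mathbb R^m$ is an $m$-dimensional manifold with or without boundary, meaning $\mathcal U=O\cup\partial O$ or $\mathcal U=O$ for some open $O\subseteq\mathbb R^m$. The environment is $\dot X_t=f(X_t,U_t)$, with $f:\mathcal X\times\mathcal U\to\mathcal X$ continuous and $t\mapsto U_t\in\mathcal U$ continuous; it is a standing assumption that the state trajectory $t\mapsto X_t$ is uniquely defined over all of $\mathbb T$ (for every initial state, in particular under every policy). A policy is a continuous function $\pi:\mathcal X\to\mathcal U$. $\mathbb G_\pi^x[Y]$ denotes the value of $Y$ when $X_0=x$ and $U_t=\pi(X_t)$ for all $t\in\mathbb T$. The reward function $r:\mathcal X\times\mathcal U\to\mathbb R$ is continuous, $R_t=r(X_t,U_t)$; $\gamma\in(0,1]$ is the discount factor and $\alpha=-\ln\gamma\ge0$. Standing assumption: $r$ attains a maximum $r_{\mathsf{max}}$,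 and $r_{\mathsf{max}}=0$ if $\gamma=1$. The value function (VF) of $\pi$ is $v_\pi(x)=\mathbb G_\pi^x[\int_0^\infty\gamma^tR_t\,dt]\in[-\infty,\infty)$. A policy $\pi$ (and its VF) is admissible iff $v_\pi(x)$ is finite for all $x\in\mathcal X$; $\mathcal V_{\mathsf a}$ is the set of admissible VFs. Standing assumption: at least one admissible policy exists, and every admissible VF is $\mathrm C^1$. Gradients $\nabla v(x)\in\mathcal X^{\mathsf T}$ are row vectors, and the Hamiltonian is $h(x,u,p)=r(x,u)+p\,f(x,u)$. Standing assumption: there is a continuous function $u_*:\mathcal X\times\mathcal X^{\mathsf T}\to\mathcal U$ with $u_*(x,p)\in\arg\max_{u\in\mathcal U}h(x,u,p)$ for all $(x,p)$. *)

theory Defs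
  imports "HOL-Analysis.Analysis"
begin

definition manifold_action_space :: "(real ^ 'm) set \<Rightarrow> bool" where
  "manifold_action_space U \<longleftrightarrow> (\<exists>S. open S \<and> (U = S \<union> frontier S \<or> U = S))"

text \<open>The dynamics and the reward are total functions of the action, but only their values
  at actions in \<open>U\<close> are constrained or used. Likewise, functions of time are total on \<open>real\<close>,
  and only their values on \<open>{0..}\<close> matter; at time 0 the derivative is one-sided.\<close>

definition state_trajectory ::
  "(real ^ 'l \<Rightarrow> real ^ 'm \<Rightarrow> real ^ 'l) \<Rightarrow> real ^ 'l \<Rightarrow> (real \<Rightarrow> real ^ 'm) \<Rightarrow> (real \<Rightarrow> real ^ 'l) \<Rightarrow> bool"
  where
  "state_trajectory f x0 A X \<longleftrightarrow>
     X 0 = x0 \<and> (\<forall>t\<ge>0. (X has_vector_derivative f (X t) (A t)) (at t within {0..}))"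

definition policy :: "(real ^ 'm) set \<Rightarrow> (real ^ 'l \<Rightarrow> real ^ 'm) \<Rightarrow> bool" where
  "policy U \<pi> \<longleftrightarrow> continuous_on UNIV \<pi> \<and> range \<pi> \<subseteq> U"

definition policy_trajectory ::
  "(real ^ 'l \<Rightarrow> real ^ 'm \<Rightarrow> real ^ 'l) \<Rightarrow> (real ^ 'l \<Rightarrow> real ^ 'm) \<Rightarrow> real ^ 'l \<Rightarrow> (real \<Rightarrow> real ^ 'l) \<Rightarrow> bool"
  where
  "policy_trajectory f \<pi> x0 X \<longleftrightarrow> state_trajectory f x0 (\<lambda>t. \<pi> (X t)) X"

definition uniquely_defined :: "((real \<Rightarrow> real ^ 'l) \<Rightarrow> bool) \<Rightarrow> bool" where
  "uniquely_defined P \<longleftrightarrow> (\<exists>X. P X \<and> (\<forall>Y. P Y \<longrightarrow> (\<forall>t\<ge>0. Y t = X t)))"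

text \<open>Unique solvability for every continuous action signal does not imply unique solvability
  of the closed loop under a merely continuous policy (take \<open>f x u = u\<close>), so both are required.\<close>

definition uniquely_defined_trajectories ::
  "(real ^ 'm) set \<Rightarrow> (real ^ 'l \<Rightarrow> real ^ 'm \<Rightarrow> real ^ 'l) \<Rightarrow> bool" where
  "uniquely_defined_trajectories U f \<longleftrightarrow>
     (\<forall>x A. continuous_on {0..} A \<and> A ` {0..} \<subseteq> U \<longrightarrow> uniquely_defined (state_trajectory f x A)) \<and>
     (\<forall>x \<pi>. policy U \<pi> \<longrightarrow> uniquely_defined (policy_trajectory f \<pi> x))"

definition the_trajectory ::
  "(real ^ 'l \<Rightarrow> real ^ 'm \<Rightarrow> real ^ 'l) \<Rightarrow> (real ^ 'l \<Rightarrow> real ^ 'm) \<Rightarrow> real ^ 'l \<Rightarrow> real \<Rightarrow> real ^ 'l"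
  where
  "the_trajectory f \<pi> x = (SOME X. policy_trajectory f \<pi> x X)"

text \<open>The integral over \<open>[0,\<infinity>)\<close> is the limit in the extended reals of the integrals over \<open>[0,T]\<close>.
  If the reward has a maximum \<open>rmax\<close>, with \<open>rmax = 0\<close> in case \<open>\<gamma> = 1\<close>, the limit exists and is less
  than \<open>\<infinity>\<close>, because the integrand is then bounded above by the integrable \<open>\<gamma> powr t * rmax\<close>.\<close>

definition value_function ::
  "(real ^ 'l \<Rightarrow> real ^ 'm \<Rightarrow> real ^ 'l) \<Rightarrow> (real ^ 'l \<Rightarrow> real ^ 'm \<Rightarrow> real) \<Rightarrow> real \<Rightarrow>
   (real ^ 'l \<Rightarrow> real ^ 'm) \<Rightarrow> real ^ 'l \<Rightarrow> ereal" where
  "value_function f r \<gamma> \<pi> x =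
     (let X = the_trajectory f \<pi> x
      in Lim at_top (\<lambda>T. ereal (integral {0..T} (\<lambda>t. \<gamma> powr t * r (X t) (\<pi> (X t))))))"

definition admissible ::
  "(real ^ 'm) set \<Rightarrow> (real ^ 'l \<Rightarrow> real ^ 'm \<Rightarrow> real ^ 'l) \<Rightarrow> (real ^ 'l \<Rightarrow> real ^ 'm \<Rightarrow> real) \<Rightarrow> real \<Rightarrow>
   (real ^ 'l \<Rightarrow> real ^ 'm) \<Rightarrow> bool" where
  "admissible U f r \<gamma> \<pi> \<longleftrightarrow> policy U \<pi> \<and> (\<forall>x. \<bar>value_function f r \<gamma> \<pi> x\<bar> \<noteq> \<infinity>)"

definition admissible_VFs ::
  "(real ^ 'm) set \<Rightarrow> (real ^ 'l \<Rightarrow> real ^ 'm \<Rightarrow> real ^ 'l) \<Rightarrow> (real ^ 'l \<Rightarrow> real ^ 'm \<Rightarrow> real) \<Rightarrow> real \<Rightarrow>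
   (real ^ 'l \<Rightarrow> ereal) set" where
  "admissible_VFs U f r \<gamma> = value_function f r \<gamma> ` {\<pi>. admissible U f r \<gamma> \<pi>}"

definition optimal_policy ::
  "(real ^ 'm) set \<Rightarrow> (real ^ 'l \<Rightarrow> real ^ 'm \<Rightarrow> real ^ 'l) \<Rightarrow> (real ^ 'l \<Rightarrow> real ^ 'm \<Rightarrow> real) \<Rightarrow> real \<Rightarrow>
   (real ^ 'l \<Rightarrow> real ^ 'm) \<Rightarrow> bool" where
  "optimal_policy U f r \<gamma> \<pi> \<longleftrightarrow>
     policy U \<pi> \<and> (\<forall>v \<in> admissible_VFs U f r \<gamma>. \<forall>x. v x \<le> value_function f r \<gamma> \<pi> x)"

text \<open>A row vector \<open>p\<close> is represented by the vector with the same entries, and its product with a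
  column vector by the inner product.\<close>

definition gradient :: "(real ^ 'l \<Rightarrow> real) \<Rightarrow> real ^ 'l \<Rightarrow> real ^ 'l" where
  "gradient v x = (THE p. GDERIV v x :> p)"

definition C1_function :: "(real ^ 'l \<Rightarrow> real) \<Rightarrow> bool" where
  "C1_function v \<longleftrightarrow> (\<exists>g. (\<forall>x. GDERIV v x :> g x) \<and> continuous_on UNIV g)"

definition hamiltonian ::
  "(real ^ 'l \<Rightarrow> real ^ 'm \<Rightarrow> real ^ 'l) \<Rightarrow> (real ^ 'l \<Rightarrow> real ^ 'm \<Rightarrow> real) \<Rightarrow>
   real ^ 'l \<Rightarrow> real ^ 'm \<Rightarrow> real ^ 'l \<Rightarrow> real" where
  "hamiltonian f r x u p = r x u + p \<bullet> f x u"

definition arg_max_set :: "('a \<Rightarrow> real) \<Rightarrow> 'a set \<Rightarrow> 'a set" where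
  "arg_max_set g S = {u. is_arg_max g (\<lambda>u. u \<in> S) u}"

text \<open>\<open>y\<close> is the attained maximum of \<open>g\<close> over \<open>S\<close>; \<open>S\<close> may be infinite, so \<open>Max\<close> does not apply.\<close>

definition is_max_value :: "('a \<Rightarrow> real) \<Rightarrow> 'a set \<Rightarrow> real \<Rightarrow> bool" where
  "is_max_value g S y \<longleftrightarrow> y \<in> g ` S \<and> (\<forall>u\<in>S. g u \<le> y)"

end

theory Submission
  imports Defs "HOL-Real_Asymp.Real_Asymp"
begin

text \<open>Policy improvement: let \<open>v\<close> be the value function of the optimal policy. Differentiating the
  discounted value along the flow shows that \<open>\<alpha> v(x)\<close> is the Hamiltonian \<open>h(x, \<pi>(x), \<nabla>v(x))\<close> of
  every admissible policy \<open>\<pi>\<close> with value function \<open>v\<close>. The greedy policy \<open>u\<^sub>*(x, \<nabla>v(x))\<close> is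
  continuous, and along its trajectories \<open>\<gamma>\<^sup>t v(X\<^sub>t)\<close> plus the reward collected so far is
  nondecreasing. Since \<open>v\<close> is bounded above, with bound 0 if \<open>\<gamma> = 1\<close>, the value of the greedy policy
  is at least \<open>v\<close>, hence equal to \<open>v\<close> by optimality. The identity for the greedy policy is then
  the HJB equation, and the identity for the optimal policy says that it attains the maximum.\<close>

section \<open>Monotonicity, limits and gradients\<close>

lemma has_derivative_nonneg_imp_le:
  fixes F :: "real \<Rightarrow> real"
  assumes der: "\<And>t. t \<ge> 0 \<Longrightarrow> (F has_real_derivative F' t) (at t within {0..})"
    and nonneg: "\<And>t. t \<ge> 0 \<Longrightarrow> F' t \<ge> 0"
    and "0 \<le> a" "a \<le> b"
  shows "F a \<le> F b"
proof (rule DERIV_nonneg_imp_increasing_open[where f = F])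
  fix t assume "a < t" "t < b"
  then have "t \<in> interior {0..}" "t \<ge> 0"
    using \<open>0 \<le> a\<close> by auto
  then have "(F has_real_derivative F' t) (at t)"
    using der[of t] by (metis at_within_interior)
  then show "\<exists>y. (F has_real_derivative y) (at t) \<and> 0 \<le> y"
    using nonneg[of t] \<open>0 \<le> a\<close> \<open>a < t\<close> by (intro exI[of _ "F' t"]) simp
next
  \<comment> \<open>Continuity covers the endpoint 0, where only a one-sided derivative is
    available.\<close>
  have "continuous_on {0..} F"
    by (rule DERIV_continuous_on[OF der]) simp
  then show "continuous_on {a..b} F"
    by (rule continuous_on_subset) (use \<open>0 \<le> a\<close> in auto)
qed (rule \<open>a \<le> b\<close>)

text \<open>The limit is taken in \<open>ereal\<close> because the infimum may be
  \<open>-\<infinity>\<close>, as happens for policies that are not admissible.\<close>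

lemma decreasing_tendsto_INF_ereal:
  fixes F :: "real \<Rightarrow> real"
  assumes "\<And>a b. 0 \<le> a \<Longrightarrow> a \<le> b \<Longrightarrow> F b \<le> F a"
  shows "((\<lambda>t. ereal (F t)) \<longlongrightarrow> (INF t\<in>{0..}. ereal (F t))) at_top"
proof (rule decreasing_tendsto)
  show "\<forall>\<^sub>F t in at_top. (INF t\<in>{0..}. ereal (F t)) \<le> ereal (F t)"
    using eventually_ge_at_top[of 0] by eventually_elim (auto intro: INF_lower)
next
  fix y assume "(INF t\<in>{0..}. ereal (F t)) < y"
  then obtain a where a: "a \<ge> 0" "ereal (F a) < y"
    by (auto simp: INF_less_iff)
  show "\<forall>\<^sub>F t in at_top. ereal (F t) < y"
    using eventually_ge_at_top[of a]
  proof eventually_elim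
    case (elim t)
    then have "ereal (F t) \<le> ereal (F a)" using assms a by simp
    then show ?case using a(2) by (rule le_less_trans)
  qed
qed

lemma gradient_eqI:
  assumes "GDERIV v x :> p"
  shows "gradient v x = p"
  unfolding gradient_def
proof (rule the_equality)
  fix q assume "GDERIV v x :> q"
  with assms have "(\<lambda>h. h \<bullet> q) = (\<lambda>h. h \<bullet> p)"
    by (simp add: gderiv_def has_derivative_unique)
  then show "q = p"
    by (metis vector_eq_ldot)
qed (rule assms)

lemma arg_max_set_iff:
  "u \<in> arg_max_set g S \<longleftrightarrow> u \<in> S \<and> (\<forall>w\<in>S. g w \<le> g u)"
  by (auto simp: arg_max_set_def is_arg_max_def not_less)

section \<open>Standing assumptions and the bound on values\<close>

locale control_problem =
  fixes U :: "(real ^ 'm) set"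
    and f :: "real ^ 'l \<Rightarrow> real ^ 'm \<Rightarrow> real ^ 'l"
    and r :: "real ^ 'l \<Rightarrow> real ^ 'm \<Rightarrow> real"
    and rmax \<gamma> \<alpha> :: real
  assumes trajectories: "uniquely_defined_trajectories U f"
    and reward_continuous: "continuous_on (UNIV \<times> U) (\<lambda>(x, u). r x u)"
    and discount_pos: "0 < \<gamma>"
    and discount_le_1: "\<gamma> \<le> 1"
    and \<alpha>_eq: "\<alpha> = - ln \<gamma>"
    and reward_max: "is_max_value (\<lambda>(x, u). r x u) (UNIV \<times> U) rmax"
    and undiscounted: "\<gamma> = 1 \<Longrightarrow> rmax = 0"
begin

abbreviation traj :: "(real ^ 'l \<Rightarrow> real ^ 'm) \<Rightarrow> real ^ 'l \<Rightarrow> real \<Rightarrow> real ^ 'l" where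
  "traj \<equiv> the_trajectory f"

abbreviation VF :: "(real ^ 'l \<Rightarrow> real ^ 'm) \<Rightarrow> real ^ 'l \<Rightarrow> ereal" where
  "VF \<equiv> value_function f r \<gamma>"

definition discounted_reward ::
  "(real ^ 'l \<Rightarrow> real ^ 'm) \<Rightarrow> real ^ 'l \<Rightarrow> real \<Rightarrow> real" where
  "discounted_reward \<pi> x t = \<gamma> powr t * r (traj \<pi> x t) (\<pi> (traj \<pi> x t))"

definition partial_return ::
  "(real ^ 'l \<Rightarrow> real ^ 'm) \<Rightarrow> real ^ 'l \<Rightarrow> real \<Rightarrow> real" where
  "partial_return \<pi> x T = integral {0..T} (discounted_reward \<pi> x)"

text \<open>The value of receiving the maximal reward \<open>rmax\<close> forever, i.e. the integral
  of \<open>\<gamma> powr t * rmax\<close> over all times. For \<open>\<gamma> = 1\<close> the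
  integrand is 0.\<close>

definition value_bound :: real where
  "value_bound = (if \<gamma> = 1 then 0 else rmax / \<alpha>)"

lemma value_bound_undiscounted: "\<gamma> = 1 \<Longrightarrow> value_bound = 0"
  unfolding value_bound_def by simp

text \<open>Makes \<open>- \<gamma> powr t * rmax\<close> the time derivative of
  \<open>\<gamma> powr t * value_bound\<close>, uniformly in both cases of the discount
  factor.\<close>

lemma \<alpha>_value_bound: "\<alpha> * value_bound = rmax"
proof (cases "\<gamma> = 1")
  case False
  then have "\<alpha> \<noteq> 0"
    using discount_pos by (simp add: \<alpha>_eq)
  with False show ?thesis
    by (simp add: value_bound_def)
qed (use undiscounted value_bound_undiscounted in simp)

lemma discounted_value_bound_tendsto: "((\<lambda>t. \<gamma> powr t * value_bound) \<longlongrightarrow> 0) at_top"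
proof (cases "\<gamma> = 1")
  case False
  then have "((\<lambda>t. \<gamma> powr t) \<longlongrightarrow> 0) at_top"
    using discount_pos discount_le_1 by real_asymp
  then show ?thesis
    by (rule tendsto_mult_left_zero)
qed (use value_bound_undiscounted in simp)

lemma discount_has_derivative:
  "((\<lambda>t. \<gamma> powr t) has_real_derivative - \<alpha> * \<gamma> powr t) (at t within S)"
  using has_field_derivative_at_within[OF has_real_derivative_const_powr[OF DERIV_ident, of \<gamma>]]
    discount_pos
  by (simp add: \<alpha>_eq)

lemma reward_le:
  assumes "u \<in> U"
  shows "r x u \<le> rmax"
proof -
  have "\<forall>w\<in>UNIV \<times> U. (\<lambda>(x, u). r x u) w \<le> rmax"
    using reward_max unfolding is_max_value_def by (rule conjunct2)
  from bspec[OF this, of "(x, u)"] show ?thesis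
    using assms by simp
qed

section \<open>Trajectories and returns under a fixed policy\<close>

context
  fixes \<pi> :: "real ^ 'l \<Rightarrow> real ^ 'm"
  assumes policy: "policy U \<pi>"
begin

lemma policy_in_actions [simp]: "\<pi> x \<in> U"
  using policy by (auto simp: policy_def)

lemma uniquely_defined_policy_trajectory: "uniquely_defined (policy_trajectory f \<pi> x)"
  using trajectories policy by (auto simp: uniquely_defined_trajectories_def)

lemma policy_trajectory_traj: "policy_trajectory f \<pi> x (traj \<pi> x)"
proof -
  have "\<exists>X. policy_trajectory f \<pi> x X"
    using uniquely_defined_policy_trajectory[of x] by (auto simp: uniquely_defined_def)
  then show ?thesis
    unfolding the_trajectory_def by (rule someI_ex)
qed

lemma traj_eqI:
  assumes "policy_trajectory f \<pi> x Y" "t \<ge> 0"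
  shows "traj \<pi> x t = Y t"
proof -
  obtain X where X: "\<And>Z. policy_trajectory f \<pi> x Z \<Longrightarrow> Z t = X t"
    using uniquely_defined_policy_trajectory[of x] \<open>t \<ge> 0\<close> unfolding uniquely_defined_def by blast
  show ?thesis
    using X[OF assms(1)] X[OF policy_trajectory_traj] by simp
qed

lemma traj_0 [simp]: "traj \<pi> x 0 = x"
  using policy_trajectory_traj[of x] by (simp add: policy_trajectory_def state_trajectory_def)

lemma traj_has_derivative:
  assumes "t \<ge> 0"
  shows "(traj \<pi> x has_vector_derivative f (traj \<pi> x t) (\<pi> (traj \<pi> x t))) (at t within {0..})"
  using policy_trajectory_traj[of x] assms
  by (simp add: policy_trajectory_def state_trajectory_def)

text \<open>The closed loop is autonomous, so the trajectory restarted at time \<open>s\<close>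
  solves the same equation from \<open>traj \<pi> x s\<close>; uniqueness identifies the
  two.\<close>

lemma traj_add:
  assumes "s \<ge> 0" "t \<ge> 0"
  shows "traj \<pi> (traj \<pi> x s) t = traj \<pi> x (s + t)"
proof (rule traj_eqI)
  show "policy_trajectory f \<pi> (traj \<pi> x s) (\<lambda>t. traj \<pi> x (s + t))"
    unfolding policy_trajectory_def state_trajectory_def
  proof safe
    fix t :: real assume "t \<ge> 0"
    have "((+) s has_vector_derivative 1) (at t within {0..})"
      by (auto intro!: derivative_eq_intros)
    moreover have "(traj \<pi> x has_vector_derivative f (traj \<pi> x (s + t)) (\<pi> (traj \<pi> x (s + t))))
        (at (s + t) within (+) s ` {0..})"
      using assms \<open>t \<ge> 0\<close>
      by (intro has_vector_derivative_within_subset[OF traj_has_derivative]) auto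
    ultimately show "((\<lambda>t. traj \<pi> x (s + t)) has_vector_derivative
        f (traj \<pi> x (s + t)) (\<pi> (traj \<pi> x (s + t)))) (at t within {0..})"
      using vector_diff_chain_within by (fastforce simp: o_def)
  qed simp
qed (rule assms)

lemma continuous_on_discounted_reward: "continuous_on {0..} (discounted_reward \<pi> x)"
proof -
  have traj: "continuous_on {0..} (traj \<pi> x)"
    by (auto simp: continuous_on_eq_continuous_within
        intro!: has_vector_derivative_continuous traj_has_derivative)
  have "continuous_on {0..} (\<lambda>t. \<pi> (traj \<pi> x t))"
    using policy by (intro continuous_on_compose2[OF _ traj]) (auto simp: policy_def)
  then have "continuous_on {0..} (\<lambda>t. (traj \<pi> x t, \<pi> (traj \<pi> x t)))"
    by (intro continuous_on_Pair traj)
  from continuous_on_compose2[OF reward_continuous this]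
  have "continuous_on {0..} (\<lambda>t. r (traj \<pi> x t) (\<pi> (traj \<pi> x t)))"
    by (simp add: image_subset_iff)
  moreover have "continuous_on {0..} (\<lambda>t. \<gamma> powr t)"
    using discount_pos by (intro continuous_intros) auto
  ultimately show ?thesis
    unfolding discounted_reward_def by (intro continuous_on_mult)
qed

lemma partial_return_has_derivative:
  assumes "t \<ge> 0"
  shows "(partial_return \<pi> x has_real_derivative discounted_reward \<pi> x t) (at t within {0..})"
proof -
  \<comment> \<open>The fundamental theorem of calculus needs a compact interval. Ending it beyond
    \<open>t\<close> leaves the filter at \<open>t\<close> the same as within
    \<open>{0..}\<close>.\<close>
  have "continuous_on {0..t+1} (discounted_reward \<pi> x)"
    by (rule continuous_on_subset[OF continuous_on_discounted_reward]) auto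
  then have "((\<lambda>T. integral {0..T} (discounted_reward \<pi> x)) has_vector_derivative
      discounted_reward \<pi> x t) (at t within {0..t+1})"
    using assms by (intro integral_has_vector_derivative) auto
  moreover have "at t within {0..t+1} = at t within {0..}"
    by (rule at_within_nhd[of _ "{..<t+1}"]) auto
  ultimately show ?thesis
    by (simp add: partial_return_def[abs_def] has_real_derivative_iff_has_vector_derivative)
qed

lemma partial_return_0 [simp]: "partial_return \<pi> x 0 = 0"
  by (simp add: partial_return_def)

lemma discounted_reward_le: "discounted_reward \<pi> x t \<le> \<gamma> powr t * rmax"
  using reward_le discount_pos by (simp add: discounted_reward_def)

text \<open>The term \<open>\<gamma> powr t * value_bound\<close> bounds the reward still to come
  after time \<open>t\<close>. Added to the partial return it gives a nonincreasing function, which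
  therefore has a limit; the added term vanishes in the limit, and the value at time 0 is the upper
  bound.\<close>

lemma VF_limit:
  shows partial_return_tendsto: "((\<lambda>T. ereal (partial_return \<pi> x T)) \<longlongrightarrow> VF \<pi> x) at_top"
    and VF_le: "VF \<pi> x \<le> ereal value_bound"
proof -
  define F where "F t = partial_return \<pi> x t + \<gamma> powr t * value_bound" for t
  define L where "L = (INF t\<in>{0..}. ereal (F t))"
  have "F b \<le> F a" if "0 \<le> a" "a \<le> b" for a b
  proof -
    have "((\<lambda>t. - F t) has_real_derivative - (discounted_reward \<pi> x t - \<gamma> powr t * rmax))
        (at t within {0..})" if "t \<ge> 0" for t
    proof -
      have eq: "\<alpha> * \<gamma> powr t * value_bound = \<gamma> powr t * rmax"
        by (metis \<alpha>_value_bound mult.assoc mult.commute)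
      then show ?thesis
        unfolding F_def
        using DERIV_minus[OF DERIV_add[OF partial_return_has_derivative[OF that, of x]
            DERIV_cmult_right[OF discount_has_derivative, of value_bound]]]
        by (simp add: eq)
    qed
    then have "- F a \<le> - F b"
      by (rule has_derivative_nonneg_imp_le[where F = "\<lambda>t. - F t"])
        (use that discounted_reward_le in auto)
    then show ?thesis by simp
  qed
  then have "((\<lambda>t. ereal (F t)) \<longlongrightarrow> L) at_top"
    unfolding L_def by (rule decreasing_tendsto_INF_ereal)
  moreover have "((\<lambda>t. ereal (- (\<gamma> powr t * value_bound))) \<longlongrightarrow> ereal (- 0)) at_top"
    by (intro tendsto_intros discounted_value_bound_tendsto)
  ultimately have "((\<lambda>t. ereal (F t) + ereal (- (\<gamma> powr t * value_bound))) \<longlongrightarrow> L + ereal (- 0)) at_top"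
    by (intro tendsto_add_ereal_general) auto
  then have *: "((\<lambda>t. ereal (partial_return \<pi> x t)) \<longlongrightarrow> L) at_top"
    by (simp add: F_def zero_ereal_def[symmetric])
  \<comment> \<open>\<open>Lim\<close> is meaningful only once convergence is known, which has just
    been shown.\<close>
  then have "VF \<pi> x = L"
    by (simp add: value_function_def partial_return_def[abs_def] discounted_reward_def[abs_def]
        tendsto_Lim)
  with * show "((\<lambda>T. ereal (partial_return \<pi> x T)) \<longlongrightarrow> VF \<pi> x) at_top"
    by simp
  have "L \<le> ereal (F 0)"
    unfolding L_def by (rule INF_lower) simp
  with \<open>VF \<pi> x = L\<close> show "VF \<pi> x \<le> ereal value_bound"
    using discount_pos by (simp add: F_def)
qed

text \<open>Split the integral at \<open>s\<close>, shift time by \<open>s\<close> in the second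
  piece, and use the semigroup property \<open>traj_add\<close>.\<close>

lemma partial_return_add:
  assumes "s \<ge> 0" "t \<ge> 0"
  shows "partial_return \<pi> x (s + t) =
    partial_return \<pi> x s + \<gamma> powr s * partial_return \<pi> (traj \<pi> x s) t"
proof -
  have "continuous_on {0..s+t} (discounted_reward \<pi> x)"
    by (rule continuous_on_subset[OF continuous_on_discounted_reward]) auto
  then have "integral {0..s} (discounted_reward \<pi> x) + integral {s..s+t} (discounted_reward \<pi> x)
      = integral {0..s+t} (discounted_reward \<pi> x)"
    using assms by (intro Henstock_Kurzweil_Integration.integral_combine integrable_continuous_real) auto
  moreover have "integral {s..s+t} (discounted_reward \<pi> x)
      = integral {0..t} (\<lambda>\<tau>. discounted_reward \<pi> x (\<tau> + s))"
    using integral_shift_real_ivl[of s s "s + t" "discounted_reward \<pi> x"] by simp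
  moreover have "integral {0..t} (\<lambda>\<tau>. discounted_reward \<pi> x (\<tau> + s))
      = integral {0..t} (\<lambda>\<tau>. \<gamma> powr s * discounted_reward \<pi> (traj \<pi> x s) \<tau>)"
    using assms
    by (intro Henstock_Kurzweil_Integration.integral_cong)
      (simp add: discounted_reward_def traj_add powr_add add.commute mult.assoc)
  ultimately show ?thesis
    by (simp add: partial_return_def)
qed

lemma discounted_function_has_derivative:
  assumes "\<And>y. GDERIV v y :> g y" and "t \<ge> 0"
  shows "((\<lambda>t. \<gamma> powr t * v (traj \<pi> x t)) has_real_derivative
      \<gamma> powr t * (g (traj \<pi> x t) \<bullet> f (traj \<pi> x t) (\<pi> (traj \<pi> x t)) - \<alpha> * v (traj \<pi> x t)))
    (at t within {0..})"
proof -
  let ?y = "traj \<pi> x t"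
  have "((\<lambda>t. v (traj \<pi> x t)) has_derivative (\<lambda>h. (h *\<^sub>R f ?y (\<pi> ?y)) \<bullet> g ?y)) (at t within {0..})"
    using assms(1)[of ?y] traj_has_derivative[OF assms(2), of x]
    unfolding gderiv_def has_vector_derivative_def
    by (rule has_derivative_compose[rotated])
  then have "((\<lambda>t. v (traj \<pi> x t)) has_real_derivative g ?y \<bullet> f ?y (\<pi> ?y)) (at t within {0..})"
    by (simp add: has_field_derivative_def inner_commute mult_commute_abs)
  from DERIV_mult[OF discount_has_derivative this] show ?thesis
    by (simp add: algebra_simps)
qed

end

section \<open>Dynamic programming and policy improvement\<close>

context
  fixes \<pi> :: "real ^ 'l \<Rightarrow> real ^ 'm"
  assumes admissible: "admissible U f r \<gamma> \<pi>"
begin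

lemma admissible_policy: "policy U \<pi>"
  using admissible by (simp add: admissible_def)

lemma admissible_VF_eq: "VF \<pi> x = ereal (real_of_ereal (VF \<pi> x))"
  using admissible by (auto simp: admissible_def ereal_real)

lemma partial_return_tendsto_real:
  "(partial_return \<pi> x \<longlongrightarrow> real_of_ereal (VF \<pi> x)) at_top"
  using partial_return_tendsto[OF admissible_policy, of x] admissible_VF_eq[of x]
  by (metis lim_ereal)

lemma real_VF_le: "real_of_ereal (VF \<pi> x) \<le> value_bound"
  using VF_le[OF admissible_policy, of x] by (subst (asm) admissible_VF_eq) simp

text \<open>Let the second duration in \<open>partial_return_add\<close> tend to infinity;
  finiteness of the values allows real limits.\<close>

lemma dynamic_programming:
  assumes "s \<ge> 0"
  shows "partial_return \<pi> x s + \<gamma> powr s * real_of_ereal (VF \<pi> (traj \<pi> x s)) = real_of_ereal (VF \<pi> x)"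
proof (rule tendsto_unique)
  show "((\<lambda>t. partial_return \<pi> x (s + t)) \<longlongrightarrow> real_of_ereal (VF \<pi> x)) at_top"
    by (rule filterlim_compose[OF partial_return_tendsto_real]) real_asymp
  have "((\<lambda>t. partial_return \<pi> x s + \<gamma> powr s * partial_return \<pi> (traj \<pi> x s) t) \<longlongrightarrow>
      partial_return \<pi> x s + \<gamma> powr s * real_of_ereal (VF \<pi> (traj \<pi> x s))) at_top"
    by (intro tendsto_intros partial_return_tendsto_real)
  then show "((\<lambda>t. partial_return \<pi> x (s + t)) \<longlongrightarrow>
      partial_return \<pi> x s + \<gamma> powr s * real_of_ereal (VF \<pi> (traj \<pi> x s))) at_top"
    by (rule Lim_transform_eventually)
      (use eventually_ge_at_top[of 0] in eventually_elim,
        simp add: partial_return_add[OF admissible_policy assms])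
qed simp

text \<open>By \<open>dynamic_programming\<close>, the return up to time \<open>s\<close> plus the
  discounted remaining value is constant in \<open>s\<close>. Its right derivative at 0 is the
  Hamiltonian minus \<open>\<alpha>\<close> times the value, so this difference is 0.\<close>

lemma hamiltonian_policy:
  assumes "\<And>y. GDERIV (\<lambda>y. real_of_ereal (VF \<pi> y)) y :> g y"
  shows "hamiltonian f r x (\<pi> x) (g x) = \<alpha> * real_of_ereal (VF \<pi> x)"
proof -
  note pol = admissible_policy
  define F where
    "F s = partial_return \<pi> x s + \<gamma> powr s * real_of_ereal (VF \<pi> (traj \<pi> x s))" for s
  have "(F has_real_derivative discounted_reward \<pi> x 0 + \<gamma> powr 0 *
      (g (traj \<pi> x 0) \<bullet> f (traj \<pi> x 0) (\<pi> (traj \<pi> x 0)) - \<alpha> * real_of_ereal (VF \<pi> (traj \<pi> x 0))))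
      (at 0 within {0..})"
    unfolding F_def
    by (rule DERIV_add[OF partial_return_has_derivative[OF pol order_refl]
          discounted_function_has_derivative[OF pol assms order_refl]])
  moreover have "(F has_real_derivative 0) (at 0 within {0..})"
    by (rule has_field_derivative_transform_within[OF DERIV_const, of 1])
      (auto simp: F_def dynamic_programming)
  \<comment> \<open>One-sided derivatives at 0 are unique because 0 is a limit point of
    \<open>{0..}\<close>.\<close>
  moreover have "at (0::real) within {0..} \<noteq> bot"
    by (simp add: at_within_Ici_at_right)
  ultimately have "discounted_reward \<pi> x 0 + \<gamma> powr 0 *
      (g (traj \<pi> x 0) \<bullet> f (traj \<pi> x 0) (\<pi> (traj \<pi> x 0)) - \<alpha> * real_of_ereal (VF \<pi> (traj \<pi> x 0))) = 0"
    by (metis has_real_derivative_iff_has_vector_derivative vector_derivative_unique_within)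
  then show ?thesis
    using discount_pos pol by (simp add: hamiltonian_def discounted_reward_def)
qed

text \<open>\<open>F t\<close> is the return of following \<open>\<pi>'\<close> up to time
  \<open>t\<close> and \<open>\<pi>\<close> afterwards. By \<open>hamiltonian_policy\<close> its
  derivative is the discounted gain in the Hamiltonian from using \<open>\<pi>'\<close> instead of
  \<open>\<pi>\<close>, which is nonnegative.\<close>

lemma policy_improvement:
  assumes grad: "\<And>y. GDERIV (\<lambda>y. real_of_ereal (VF \<pi> y)) y :> g y"
    and pol': "policy U \<pi>'"
    and better: "\<And>y. hamiltonian f r y (\<pi> y) (g y) \<le> hamiltonian f r y (\<pi>' y) (g y)"
  shows "VF \<pi> x \<le> VF \<pi>' x"
proof -
  define v where "v y = real_of_ereal (VF \<pi> y)" for y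
  define F where "F t = partial_return \<pi>' x t + \<gamma> powr t * v (traj \<pi>' x t)" for t
  define F' where "F' t = discounted_reward \<pi>' x t + \<gamma> powr t *
      (g (traj \<pi>' x t) \<bullet> f (traj \<pi>' x t) (\<pi>' (traj \<pi>' x t)) - \<alpha> * v (traj \<pi>' x t))" for t
  have "v x \<le> partial_return \<pi>' x t + \<gamma> powr t * value_bound" if "t \<ge> 0" for t
  proof -
    have "F 0 \<le> F t"
    proof (rule has_derivative_nonneg_imp_le[of F F'])
      fix s :: real assume "s \<ge> 0"
      show "(F has_real_derivative F' s) (at s within {0..})"
        unfolding F_def F'_def v_def
        by (rule DERIV_add[OF partial_return_has_derivative[OF pol' \<open>s \<ge> 0\<close>]
              discounted_function_has_derivative[OF pol' grad \<open>s \<ge> 0\<close>]])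
      let ?y = "traj \<pi>' x s"
      have "\<gamma> powr s * (hamiltonian f r ?y (\<pi>' ?y) (g ?y) - \<alpha> * v ?y) \<ge> 0"
        using better[of ?y] hamiltonian_policy[OF grad] by (simp add: v_def)
      then show "F' s \<ge> 0"
        by (simp add: F'_def hamiltonian_def discounted_reward_def algebra_simps)
    qed (use that in auto)
    moreover have "F 0 = v x"
      using discount_pos pol' by (simp add: F_def)
    \<comment> \<open>The remaining value along the trajectory of \<open>\<pi>'\<close> need not
      converge, but this upper bound for it tends to 0.\<close>
    moreover have "\<gamma> powr t * v (traj \<pi>' x t) \<le> \<gamma> powr t * value_bound"
      using real_VF_le by (simp add: v_def mult_left_mono)
    ultimately show ?thesis
      by (simp add: F_def)
  qed
  then have le: "\<forall>\<^sub>F t in at_top. ereal (v x) \<le> ereal (partial_return \<pi>' x t) + ereal (\<gamma> powr t * value_bound)"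
    by (auto intro: eventually_at_top_linorderI[of 0])
  \<comment> \<open>Admissibility of \<open>\<pi>'\<close> is not yet known, so the limit is taken
    in \<open>ereal\<close>.\<close>
  have "((\<lambda>t. ereal (partial_return \<pi>' x t) + ereal (\<gamma> powr t * value_bound))
      \<longlongrightarrow> VF \<pi>' x + ereal 0) at_top"
    using partial_return_tendsto[OF pol'] tendsto_ereal[OF discounted_value_bound_tendsto]
    by (intro tendsto_add_ereal_general) simp_all
  from this le have "ereal (v x) \<le> VF \<pi>' x + ereal 0"
    by (rule tendsto_lowerbound) simp
  moreover have "VF \<pi> x = ereal (v x)"
    unfolding v_def by (rule admissible_VF_eq)
  ultimately show ?thesis
    by (metis zero_ereal_def add.right_neutral)
qed

end

text \<open>A finite value from below excludes \<open>-\<infinity>\<close>, and \<open>VF_le\<close>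
  excludes \<open>\<infinity>\<close>.\<close>

lemma admissible_mono:
  assumes "admissible U f r \<gamma> \<pi>" "policy U \<pi>'" "\<And>x. VF \<pi> x \<le> VF \<pi>' x"
  shows "admissible U f r \<gamma> \<pi>'"
  unfolding admissible_def
proof (intro conjI allI)
  fix x
  have "\<bar>VF \<pi> x\<bar> \<noteq> \<infinity>"
    using assms(1) by (simp add: admissible_def)
  then have "VF \<pi> x \<noteq> - \<infinity>"
    by auto
  with assms(3)[of x] have "VF \<pi>' x \<noteq> - \<infinity>"
    by (metis ereal_infty_less_eq(2))
  moreover have "VF \<pi>' x \<noteq> \<infinity>"
    using VF_le[OF assms(2), of x] by (metis PInfty_neq_ereal(1) ereal_infty_less_eq(1))
  ultimately show "\<bar>VF \<pi>' x\<bar> \<noteq> \<infinity>"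
    by (metis ereal_infinity_cases)
qed (rule assms(2))

end

section \<open>The Hamilton-Jacobi-Bellman equation\<close>

theorem theorem2p8:
  fixes U :: "(real ^ 'm) set"
    and f :: "real ^ 'l \<Rightarrow> real ^ 'm \<Rightarrow> real ^ 'l"
    and r :: "real ^ 'l \<Rightarrow> real ^ 'm \<Rightarrow> real"
    and rmax \<gamma> \<alpha> :: real
    and ustar :: "real ^ 'l \<Rightarrow> real ^ 'l \<Rightarrow> real ^ 'm"
    and \<pi>star :: "real ^ 'l \<Rightarrow> real ^ 'm"
    and vstar :: "real ^ 'l \<Rightarrow> real"
  assumes "manifold_action_space U"
    and "continuous_on (UNIV \<times> U) (\<lambda>(x, u). f x u)"
    and "uniquely_defined_trajectories U f"
    and "continuous_on (UNIV \<times> U) (\<lambda>(x, u). r x u)"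
    and "0 < \<gamma>" and "\<gamma> \<le> 1"
    and "\<alpha> = - ln \<gamma>"
    and "is_max_value (\<lambda>(x, u). r x u) (UNIV \<times> U) rmax"
    and "\<gamma> = 1 \<Longrightarrow> rmax = 0"
    and "\<exists>\<pi>. admissible U f r \<gamma> \<pi>"
    and "\<forall>v \<in> admissible_VFs U f r \<gamma>. C1_function (\<lambda>x. real_of_ereal (v x))"
    and "continuous_on UNIV (\<lambda>(x, p). ustar x p)"
    and "\<forall>x p. ustar x p \<in> arg_max_set (\<lambda>u. hamiltonian f r x u p) U"
    and "optimal_policy U f r \<gamma> \<pi>star"
    and "vstar = (\<lambda>x. real_of_ereal (value_function f r \<gamma> \<pi>star x))"
  shows "admissible U f r \<gamma> \<pi>star \<and>
         (\<forall>x. is_max_value (\<lambda>u. hamiltonian f r x u (gradient vstar x)) U (\<alpha> * vstar x)) \<and>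
         (\<forall>x. \<pi>star x \<in> arg_max_set (\<lambda>u. hamiltonian f r x u (gradient vstar x)) U)"
proof -
  interpret control_problem U f r rmax \<gamma> \<alpha>
    by unfold_locales (use assms in auto)
  \<comment> \<open>\<open>optimal_policy\<close> does not ask for finite values; they follow
    because \<open>\<pi>star\<close> dominates some admissible policy.\<close>
  have adm: "admissible U f r \<gamma> \<pi>star"
  proof -
    obtain \<pi> where \<pi>: "admissible U f r \<gamma> \<pi>"
      using assms(10) by blast
    show ?thesis
      by (rule admissible_mono[OF \<pi>]) (use assms(14) \<pi> in \<open>auto simp: optimal_policy_def admissible_VFs_def\<close>)
  qed
  then have "C1_function vstar"
    using assms(11) by (auto simp: assms(15) admissible_VFs_def)
  then obtain g where grad: "\<And>x. GDERIV vstar x :> g x" and g_cont: "continuous_on UNIV g"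
    by (auto simp: C1_function_def)
  define \<pi>' where "\<pi>' x = ustar x (g x)" for x
  have greedy: "\<pi>' x \<in> U" "u \<in> U \<Longrightarrow> hamiltonian f r x u (g x) \<le> hamiltonian f r x (\<pi>' x) (g x)" for x u
    using assms(13) by (auto simp: \<pi>'_def arg_max_set_iff)
  have "continuous_on UNIV (\<lambda>x. (x, g x))"
    by (intro continuous_intros g_cont)
  from continuous_on_compose2[OF assms(12) this] have pol': "policy U \<pi>'"
    using greedy(1) by (auto simp: policy_def \<pi>'_def)
  note grad' = grad[unfolded assms(15)]
  have improve: "VF \<pi>star x \<le> VF \<pi>' x" for x
    using adm grad' pol' greedy(2) policy_in_actions[OF admissible_policy[OF adm]]
    by (intro policy_improvement) auto
  \<comment> \<open>Optimality compares only with admissible value functions, so the greedy policy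
    must be shown admissible first.\<close>
  then have adm': "admissible U f r \<gamma> \<pi>'"
    by (rule admissible_mono[OF adm pol'])
  then have "VF \<pi>' x \<le> VF \<pi>star x" for x
    using assms(14) by (auto simp: optimal_policy_def admissible_VFs_def)
  with improve have VF_eq: "VF \<pi>' = VF \<pi>star"
    by (auto intro!: ext antisym)
  \<comment> \<open>Both policies have the same value function, so the same gradient
    \<open>g\<close> serves in both identities.\<close>
  have "hamiltonian f r x (\<pi>' x) (g x) = \<alpha> * vstar x" for x
    using hamiltonian_policy[OF adm', of g x] grad' by (simp add: VF_eq assms(15))
  moreover have "hamiltonian f r x (\<pi>star x) (g x) = \<alpha> * vstar x" for x
    using hamiltonian_policy[OF adm, of g x] grad' by (simp add: assms(15))
  ultimately show ?thesis
    using adm greedy policy_in_actions[OF admissible_policy[OF adm]]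
    unfolding gradient_eqI[OF grad] arg_max_set_iff is_max_value_def
    by (metis image_eqI)
qed

end
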